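(* Let $f\colon\{0,2,4,6\}\to\mathbb{N}$ be any function such that, for infinitely many $n\in\mathbb{N}$, there exists a two-player $f$-code $E_1,E_2\colon\binom{[2n]}{n}\to\{0,1\}^{m(n)}$. Then $f(4)=\tfrac{1}{2}\big(f(2)+f(6)\big)$.
   Context: $\binom{[2n]}{n}$ denotes the set of strings in $\{0,1\}^{2n}$ of Hamming weight exactly $n$ (identified with $n$-element subsets of $[2n]$), and $\mathrm{dist}$ is Hamming distance. For $f$ with domain $\mathcal{D}\subseteq\mathbb{N}$ and a set $\mathcal{X}$ of strings, a pair of maps $E_1,E_2\colon\mathcal{X}\to\{0,1\}^m$ is a two-player $f$-code if $\mathrm{dist}(E_1(x),E_2(y))=f(\mathrm{dist}(x,y))$ for all $x,y\in\mathcal{X}$ with $\mathrm{dist}(x,y)\in\mathcal{D}$. Here $m(n)$ is some function of $n$. *)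

theory Defs
  imports Complex_Main "HOL-Library.FuncSet"
begin

definition bitstrings :: "nat \<Rightarrow> bool list set" where
  "bitstrings m = {x. length x = m}"

definition hamming_weight :: "bool list \<Rightarrow> nat" where
  "hamming_weight x = card {i. i < length x \<and> x ! i}"

(* Only applied to strings of equal length. *)
definition hamming_dist :: "bool list \<Rightarrow> bool list \<Rightarrow> nat" where
  "hamming_dist x y = card {i. i < length x \<and> x ! i \<noteq> y ! i}"

definition middle_slice :: "nat \<Rightarrow> bool list set" where
  "middle_slice n = {x \<in> bitstrings (2 * n). hamming_weight x = n}"

(* A function with domain D is represented by a total function together with D;
   its values outside D are never used. *)
definition two_player_code ::
  "nat set \<Rightarrow> (nat \<Rightarrow> nat) \<Rightarrow> bool list set \<Rightarrow> nat \<Rightarrow>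
   (bool list \<Rightarrow> bool list) \<Rightarrow> (bool list \<Rightarrow> bool list) \<Rightarrow> bool" where
  "two_player_code D f X m E1 E2 \<longleftrightarrow>
     E1 \<in> X \<rightarrow> bitstrings m \<and> E2 \<in> X \<rightarrow> bitstrings m \<and>
     (\<forall>x\<in>X. \<forall>y\<in>X. hamming_dist x y \<in> D \<longrightarrow>
        hamming_dist (E1 x) (E2 y) = f (hamming_dist x y))"

end

theory Submission
  imports Defs "HOL-Library.Ramsey"
begin

text \<open>
  Padding identifies sets \<open>{c} \<union> I\<close>, with \<open>I\<close> of fixed size \<open>k\<close>, with strings in the slice. Let \<open>u(I)\<close> and
  \<open>v(I)\<close> be the changes of \<open>E1\<close> and \<open>E2\<close> when \<open>c\<close> switches between two fixed values. These vectors over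
  \<open>{-1, 0, 1}\<close> have at most \<open>K = f 0 + f 2\<close> nonzero entries, and if \<open>card (I - I') = d \<le> 2\<close> then
  \<open>u(I) \<bullet> v(I') = f (2d + 2) - f (2d)\<close>. If the claim fails, the values for \<open>d = 1\<close> and \<open>d = 2\<close> differ.

  By Ramsey's theorem we may assume that the pattern of \<open>v\<close> on a finite set depends only on the order type
  of that set. Let \<open>I = {z 1 < ... < z k}\<close>, and let \<open>J p y\<close> be \<open>{z 1, ..., z (k+1)}\<close> with \<open>z p\<close> and \<open>z (p+1)\<close>
  replaced by \<open>y\<close>. Replacing \<open>y = z (p+1)\<close> by a fresh point moves the distance of \<open>J p y\<close> to \<open>I\<close> from 1 to 2,
  so some coordinate in the support of \<open>u(I)\<close> notices. For large \<open>k\<close> a single coordinate does so for more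
  than \<open>K\<close> values of \<open>p\<close>. It does not notice when \<open>z p\<close> itself, a point absent from \<open>J p y\<close>, moves a little.
  Transporting each of these \<open>J p y\<close> to \<open>I\<close> turns this coordinate into pairwise distinct elements of the
  support of \<open>v(I)\<close>, which is too small.
\<close>

section \<open>Sparse sign vectors whose patterns depend only on order types\<close>

text \<open>The partner \<open>e'\<close> in \<open>transport\<close> may depend on
  \<open>S\<close>, \<open>g\<close> and \<open>e\<close>, but it serves all subsets of
  \<open>S\<close> at once. So equalities and inequalities among the values of one coordinate are
  transported together.\<close>

locale sparse_homogeneous =
  fixes v :: "'e \<Rightarrow> nat set \<Rightarrow> int" and E :: "'e set" and k K M w :: nat
  assumes fin: "finite E"
    and range: "\<And>e P. e \<in> E \<Longrightarrow> v e P \<in> {-1, 0, 1}"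
    and sparse: "\<And>P. P \<subseteq> {..<M} \<Longrightarrow> card P = k \<Longrightarrow> card {e \<in> E. v e P \<noteq> 0} \<le> K"
    and transport: "\<And>S g e. \<lbrakk>S \<subseteq> {..<M}; card S \<le> w; strict_mono_on S g; g ` S \<subseteq> {..<M}; e \<in> E\<rbrakk>
      \<Longrightarrow> \<exists>e'\<in>E. \<forall>P\<subseteq>S. v e P = v e' (g ` P)"
begin

text \<open>
  The coordinates distinguishing \<open>P1\<close> from \<open>P2\<close> are at most \<open>2K\<close> many, so they cannot separate all points of
  a long interval that avoids \<open>P1\<close> and \<open>P2\<close>; by homogeneity they separate none.
\<close>
lemma insensitive_less:
  assumes "P1 \<subseteq> R" "card P1 = k" "P2 \<subseteq> R" "card P2 = k" "Q \<subseteq> R"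
    and e: "e \<in> E" "v e P1 \<noteq> v e P2"
    and R: "R \<subseteq> {..<M}" "R \<inter> {lo..hi} = {}" "card R + 2 \<le> w"
    and hi: "hi < M" "lo + 9 ^ K \<le> hi"
    and ab: "a \<in> {lo..hi}" "b \<in> {lo..hi}" "a < b"
  shows "v e (insert a Q) = v e (insert b Q)"
proof (rule ccontr)
  assume ne: "v e (insert a Q) \<noteq> v e (insert b Q)"
  define D where "D = {e \<in> E. v e P1 \<noteq> v e P2}"
  have finR: "finite R" using R(1) finite_subset by blast
  \<comment> \<open>Homogeneity carries the pair \<open>a\<close>, \<open>b\<close> to any pair
    \<open>c\<close>, \<open>d\<close> of the interval while fixing \<open>R\<close>. As
    \<open>P1\<close> and \<open>P2\<close> stay fixed, the partner coordinate still lies in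
    \<open>D\<close>.\<close>
  have sep: "\<exists>e'\<in>D. v e' (insert c Q) \<noteq> v e' (insert d Q)"
    if cd: "c \<in> {lo..hi}" "d \<in> {lo..hi}" "c < d" for c d
  proof -
    define g where "g = id(a := c, b := d)"
    have gR: "g x = x" if "x \<in> R" for x
      using that R(2) ab by (auto simp: g_def)
    have gab: "g a = c" "g b = d" using ab by (auto simp: g_def)
    have gim: "g ` P = P" if "P \<subseteq> R" for P
      using gR that by (force simp: image_iff)
    let ?S = "insert a (insert b R)"
    have out: "x < lo \<or> x > hi" if "x \<in> R" for x using R(2) that by (meson atLeastAtMost_iff disjoint_iff linorder_not_less)
    have S1: "?S \<subseteq> {..<M}" using R(1) ab hi by auto
    have S2: "card ?S \<le> w"
      using R(3) finR by (simp add: card_insert_if)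
    have S3: "strict_mono_on ?S g"
    proof (rule strict_mono_onI)
      fix r s assume "r \<in> ?S" "s \<in> ?S" "r < s"
      moreover have "g x = (if x = a then c else if x = b then d else x)" if "x \<in> ?S" for x
        using that gR gab by auto
      ultimately show "g r < g s"
        using ab cd out[of r] out[of s] by auto
    qed
    have S4: "g ` ?S \<subseteq> {..<M}"
      using R(1) cd hi gR gab by auto
    obtain e' where e': "e' \<in> E" "\<forall>P\<subseteq>?S. v e P = v e' (g ` P)"
      using transport[OF S1 S2 S3 S4 e(1)] by (elim bexE)
    have 1: "v e P = v e' P" if "P \<subseteq> R" for P
      using e'(2)[rule_format, of P] gim[OF that] that by auto
    have "v e (insert a Q) = v e' (insert c Q)" "v e (insert b Q) = v e' (insert d Q)"
      using e'(2)[rule_format, of "insert a Q"] e'(2)[rule_format, of "insert b Q"]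
        gim[OF assms(5)] gab assms(5) by auto
    then show ?thesis using ne e' e(2) 1[OF assms(1)] 1[OF assms(3)] by (auto simp: D_def)
  qed
  \<comment> \<open>The \<open>F c\<close> are pairwise distinct sign vectors on \<open>D\<close>.
    At most \<open>3 ^ (2 * K) = 9 ^ K\<close> of these exist, but the interval has at least
    \<open>9 ^ K + 1\<close> points.\<close>
  define F where "F c = restrict (\<lambda>e. v e (insert c Q)) D" for c
  have "inj_on F {lo..hi}"
  proof (rule linorder_inj_onI')
    fix c d assume "c \<in> {lo..hi}" "d \<in> {lo..hi}" "c < d"
    then obtain e' where "e' \<in> D" "v e' (insert c Q) \<noteq> v e' (insert d Q)" using sep by blast
    then have "F c e' \<noteq> F d e'" by (simp add: F_def)
    then show "F c \<noteq> F d" by auto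
  qed
  moreover have "F ` {lo..hi} \<subseteq> D \<rightarrow>\<^sub>E {-1, 0, 1}"
    using range unfolding F_def image_subset_iff restrict_PiE_iff D_def by blast
  moreover have finD: "finite D" using fin by (simp add: D_def)
  then have "finite (D \<rightarrow>\<^sub>E {-1, 0, 1 :: int})" by (simp add: finite_PiE)
  ultimately have "card {lo..hi} \<le> card (D \<rightarrow>\<^sub>E {-1, 0, 1 :: int})"
    by (rule card_inj_on_le)
  also have "\<dots> = 3 ^ card D" using finD by (simp add: card_funcsetE numeral_3_eq_3)
  also have "card D \<le> 2 * K"
  proof -
    have "D \<subseteq> {e \<in> E. v e P1 \<noteq> 0} \<union> {e \<in> E. v e P2 \<noteq> 0}" by (auto simp: D_def)
    then have "card D \<le> card ({e \<in> E. v e P1 \<noteq> 0} \<union> {e \<in> E. v e P2 \<noteq> 0})"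
      using fin by (intro card_mono) auto
    also have "\<dots> \<le> card {e \<in> E. v e P1 \<noteq> 0} + card {e \<in> E. v e P2 \<noteq> 0}" by (rule card_Un_le)
    also have "\<dots> \<le> K + K" using assms R(1) by (intro add_mono sparse) auto
    finally show ?thesis by simp
  qed
  then have "(3::nat) ^ card D \<le> 3 ^ (2 * K)" by (intro power_increasing) auto
  also have "\<dots> = 9 ^ K" by (simp add: power_mult)
  finally show False using hi by simp
qed

lemma insensitive:
  assumes "P1 \<subseteq> R" "card P1 = k" "P2 \<subseteq> R" "card P2 = k" "Q \<subseteq> R"
    and "e \<in> E" "v e P1 \<noteq> v e P2"
    and "R \<subseteq> {..<M}" "R \<inter> {lo..hi} = {}" "card R + 2 \<le> w"
    and "hi < M" "lo + 9 ^ K \<le> hi"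
    and "a \<in> {lo..hi}" "b \<in> {lo..hi}"
  shows "v e (insert a Q) = v e (insert b Q)"
  using insensitive_less[OF assms(1-12), of a b] insensitive_less[OF assms(1-12), of b a] assms(13,14)
  by (metis linorder_neq_iff)


text \<open>Sensitivity to the switch at \<open>p\<close> for every \<open>p\<close> forces more
  than \<open>K\<close> coordinates into the support of one set. \<open>F\<close> stands for the
  support of \<open>u(I)\<close>. The spacing \<open>B\<close> leaves room around each multiple for
  an interval to which \<open>insensitive\<close> applies.\<close>

lemma no_sensitive_chain:
  fixes B :: nat and F :: "'e set"
  defines "L \<equiv> \<lambda>p. (\<lambda>i. B * i) ` ({1..k+1} - {p, p+1})"
  assumes k: "k = 2 * K * K + 2" and B: "B = 9 ^ K + 4" and w: "2 * k + 4 \<le> w"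
    and M: "B * (k + 2) \<le> M"
    and F: "F \<subseteq> E" "card F \<le> K"
    and chain: "\<And>p. 1 \<le> p \<Longrightarrow> p < k \<Longrightarrow>
      \<exists>e\<in>F. v e (insert (B * (p + 1)) (L p)) \<noteq> v e (insert (B * p + 2) (L p))"
  shows False
proof -
  define z where "z i = B * i" for i
  \<comment> \<open>\<open>J True p\<close> and \<open>J False p\<close> are at distance 1 and 2 from \<open>z ` {1..k}\<close>.\<close>
  define y where "y b p = (if b then z (p + 1) else z p + 2)" for b p
  define J where "J b p = insert (y b p) (L p)" for b p
  have L: "L p = z ` ({1..k+1} - {p, p+1})" for p by (simp add: L_def z_def)
  have zB: "z i + B \<le> z j" if "i < j" for i j
  proof -
    have "B * (i + 1) \<le> B * j" using that by (intro mult_le_mono) auto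
    then show ?thesis by (simp add: z_def)
  qed
  have B4: "5 \<le> B" using B by simp
  have zz: "z i + 5 \<le> z j" if "i < j" for i j using zB[OF that] B4 by simp
  have zle: "z i \<le> z j" if "i \<le> j" for i j unfolding z_def using that by (rule mult_le_mono2)
  have injz: "inj z" using B4 by (auto simp: inj_def z_def)
  have zM: "z i + 3 < M" if "i \<le> k + 1" for i
    using zz[of i "k+2"] that M by (simp add: z_def)
  have zlt: "z i < M" if "i \<le> k + 1" for i using zM[OF that] by simp
  have z1: "5 \<le> z i" if "1 \<le> i" for i using zz[of 0 i] that by (simp add: z_def)
  have finF: "finite F" using F(1) fin finite_subset by blast
  have yL: "y b p \<notin> L p" for b p
  proof
    assume "y b p \<in> L p"
    then obtain i where "y b p = z i" "i \<noteq> p" "i \<noteq> p + 1" by (auto simp: L)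
    then show False using zz[of i p] zz[of i "p+1"] zz[of "p+1" i] zz[of p "p+1"] B4
      by (cases b; cases "i < p"; cases "i < p + 1") (auto simp: y_def)
  qed
  have cardL: "card (L p) = k - 1" if "1 \<le> p" "p < k" for p
  proof -
    have "card (L p) = card ({1..k+1} - {p, p+1})" unfolding L
      using injz by (intro card_image) (auto simp: inj_on_def)
    also have "\<dots> = card {1..k+1} - card {p, p+1}" using that by (intro card_Diff_subset) auto
    finally show ?thesis by simp
  qed
  have cardJ: "card (J b p) = k" if "1 \<le> p" "p < k" for b p
    using cardL[OF that] yL[of b p] k by (simp add: J_def L)
  \<comment> \<open>The two values differ, so one is nonzero; the Boolean in \<open>c\<close>
    records which of \<open>J True p\<close> and \<open>J False p\<close> has the coordinate in its
    support.\<close>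
  have "\<exists>c\<in>F \<times> UNIV. v (fst c) (J True p) \<noteq> v (fst c) (J False p) \<and> v (fst c) (J (snd c) p) \<noteq> 0"
    if "p \<in> {1..<k}" for p
  proof -
    have "1 \<le> p" "p < k" using that by auto
    then obtain e where e: "e \<in> F" "v e (J True p) \<noteq> v e (J False p)"
      using chain[of p] unfolding J_def y_def z_def by auto
    then obtain b where "v e (J b p) \<noteq> 0" by metis
    then show ?thesis using e by force
  qed
  then obtain h where h: "\<And>p. p \<in> {1..<k} \<Longrightarrow> h p \<in> F \<times> UNIV"
    "\<And>p. p \<in> {1..<k} \<Longrightarrow> v (fst (h p)) (J True p) \<noteq> v (fst (h p)) (J False p)"
    "\<And>p. p \<in> {1..<k} \<Longrightarrow> v (fst (h p)) (J (snd (h p)) p) \<noteq> 0"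
    by metis
  \<comment> \<open>There are \<open>k - 1 = 2 * K * K + 1\<close> values of \<open>p\<close> and at
    most \<open>2 * K\<close> pairs, so some pair occurs more than \<open>K\<close> times.\<close>
  have "\<exists>c\<in>F \<times> (UNIV::bool set). card (h -` {c} \<inter> {1..<k}) * card (F \<times> (UNIV::bool set)) \<ge> card {1..<k}"
    using h(1)[of 1] h(1) finF k by (intro pigeonhole_card) auto
  then obtain e b where eb: "e \<in> F" "card {1..<k} \<le> card (h -` {(e, b)} \<inter> {1..<k}) * card (F \<times> (UNIV::bool set))"
    by auto
  define P where "P = h -` {(e, b)} \<inter> {1..<k}"
  have finP: "finite P" by (simp add: P_def)
  have cardP: "K < card P"
  proof (rule ccontr)
    assume "\<not> K < card P"
    moreover have "card (F \<times> (UNIV::bool set)) \<le> 2 * K" using F(2) by (simp add: card_cartesian_product)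
    ultimately have "card P * card (F \<times> (UNIV::bool set)) \<le> K * (2 * K)" by (intro mult_le_mono) auto
    then show False using eb(2) k by (simp add: P_def)
  qed
  have eE: "e \<in> E" using eb F by blast
  have P: "1 \<le> p" "p < k" "v e (J True p) \<noteq> v e (J False p)" "v e (J b p) \<noteq> 0" if "p \<in> P" for p
    using that h(2,3)[of p] by (auto simp: P_def)
  \<comment> \<open>The direction in which \<open>y b p\<close> has to move to become \<open>y (\<not> b) p\<close>.\<close>
  define sh where "sh x = (if b then x - 1 else x + 1)" for x :: nat
  \<comment> \<open>Both \<open>J True q\<close> and \<open>J False q\<close> avoid
    \<open>z q\<close>, and \<open>e\<close> tells them apart. With these as \<open>P1\<close> and
    \<open>P2\<close>, \<open>insensitive\<close> lets \<open>z q\<close> move inside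
    \<open>J b p\<close>.\<close>
  have ins: "v e (insert (sh (z q)) (J b p - {z q})) = v e (J b p)" if "q \<in> P" "p \<in> P" "q < p" for p q
  proof -
    define R where "R = z ` ({1..k+1} - {q}) \<union> {z q + 2, z p + 2}"
    have qk: "1 \<le> q" "q < k" "1 \<le> p" "p < k" using P that by auto
    have R1: "J True q \<subseteq> R" "J False q \<subseteq> R"
      using qk by (auto simp: J_def y_def R_def L)
    have R2: "J b p - {z q} \<subseteq> R"
      using qk by (auto simp: J_def y_def R_def L)
    have R3: "R \<subseteq> {..<M}"
      using zM[of q] zM[of p] qk by (auto simp: R_def intro: zlt)
    have zq: "z q \<ge> 9 ^ K + 4" using zB[of 0 q] qk B by (simp add: z_def)
    \<comment> \<open>The interval stops at \<open>z q + 1\<close> because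
      \<open>y False q = z q + 2\<close> lies in \<open>R\<close>, and it starts above
      \<open>z (q - 1) = z q - (9 ^ K + 4)\<close>. It contains \<open>z q\<close> and both possible
      shifts.\<close>
    have R4: "R \<inter> {z q - (9 ^ K + 2)..z q + 1} = {}"
    proof -
      have "z i \<notin> {z q - (9 ^ K + 2)..z q + 1}" if "i \<noteq> q" for i
        using zB[of i q] zB[of q i] that B zq by (cases "i < q") auto
      moreover have "z q + 2 \<notin> {z q - (9 ^ K + 2)..z q + 1}" "z p + 2 \<notin> {z q - (9 ^ K + 2)..z q + 1}"
        using zz[of q p] \<open>q < p\<close> by auto
      ultimately show ?thesis unfolding R_def by blast
    qed
    have R5: "card R + 2 \<le> w"
    proof -
      have "card R \<le> card (z ` ({1..k+1} - {q})) + card {z q + 2, z p + 2}"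
        unfolding R_def by (rule card_Un_le)
      also have "\<dots> \<le> card ({1..k+1} - {q}) + 2"
        by (intro add_mono card_image_le) (auto simp: card_insert_if)
      finally show ?thesis using w qk by simp
    qed
    have "v e (insert (z q) (J b p - {z q})) = v e (insert (sh (z q)) (J b p - {z q}))"
      by (rule insensitive[OF R1(1) cardJ R1(2) cardJ R2 eE _ R3 R4 R5])
        (use P[OF that(1)] qk zM[of q] zq in \<open>auto simp: sh_def\<close>)
    moreover have "z q \<in> J b p" using qk \<open>q < p\<close> by (auto simp: J_def L)
    ultimately show ?thesis by (simp add: insert_absorb)
  qed
  define I where "I = z ` {1..k}"
  \<comment> \<open>The coordinate found for \<open>p\<close> lies in the support at
    \<open>I\<close>, reacts to the shift of \<open>z p\<close> and ignores the shift of
    \<open>z q\<close> for smaller \<open>q\<close> in \<open>P\<close>. This triangular pattern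
    will keep the coordinates for different \<open>p\<close> apart.\<close>
  have "\<exists>e'\<in>E. v e' I = v e (J b p) \<and> v e' (insert (sh (z p)) (I - {z p})) = v e (J (\<not> b) p) \<and>
      (\<forall>q\<in>P. q < p \<longrightarrow> v e' (insert (sh (z q)) (I - {z q})) = v e (J b p))" if p: "p \<in> P" for p
  proof -
    note pk = P(1,2)[OF p]
    define N where "N = {q \<in> P. q < p}"
    define S where "S = L p \<union> {y b p, y (\<not> b) p} \<union> (\<lambda>q. sh (z q)) ` N"
    \<comment> \<open>\<open>g\<close> turns \<open>J b p\<close> into \<open>I\<close>:
      \<open>y b p\<close> goes to \<open>z p\<close>, and later points drop by \<open>B\<close>.
      The alternative \<open>y (\<not> b) p\<close> goes to the neighbour of \<open>z p\<close> on
      the corresponding side.\<close>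
    define g where "g x = (if x < z p then x else if x = y b p then z p
      else if x = y (\<not> b) p then sh (z p) else x - B)" for x
    have yp: "z p < y c p" "y c p < z (p + 2)" "y True p = z p + B" "y False p = z p + 2" for c
      using zz[of p "p+1"] zz[of "p+1" "p+2"] zz[of p "p+2"] by (auto simp: y_def) (auto simp: z_def)
    have glo: "g x = x" if "x < z p" for x using that by (simp add: g_def)
    have gy: "g (y b p) = z p" "g (y (\<not> b) p) = sh (z p)"
      using yp(1)[of b] yp(1)[of "\<not> b"] yp(3,4) B4 by (auto simp: g_def y_def)
    have ghi: "g (z i) = z (i - 1)" if "p + 2 \<le> i" for i
    proof -
      have "z (p + 2) \<le> z i" using that by (rule zle)
      moreover have "z i - B = z (i - 1)" by (simp add: z_def diff_mult_distrib2)
      ultimately show ?thesis using yp(1)[of b] yp(2)[of b] yp(2)[of "\<not> b"] by (simp add: g_def)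
    qed
    have glz: "g (z i) = z i" if "i < p" for i using zz[OF that] glo by simp
    have gls: "g (sh (z i)) = sh (z i)" if "i < p" for i using zz[OF that] glo by (simp add: sh_def)
    have Scases: "(x < z p \<and> g x = x) \<or> (x = y b p \<and> g x = z p) \<or> (x = y (\<not> b) p \<and> g x = sh (z p))
      \<or> (\<exists>i. p + 2 \<le> i \<and> i \<le> k + 1 \<and> x = z i \<and> g x = z (i - 1))" if xS: "x \<in> S" for x
    proof -
      consider i where "i \<in> {1..k+1} - {p, p+1}" "x = z i" | "x = y b p" | "x = y (\<not> b) p"
        | q where "q < p" "x = sh (z q)"
        using xS unfolding S_def L N_def by blast
      then show ?thesis
      proof cases
        case 1
        then show ?thesis using glz zz[of i p] ghi[of i]
          by (cases "i < p") (auto intro!: exI[of _ i])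
      next
        case 4
        then have "x < z p" using zz[of q p] by (cases b) (auto simp: sh_def)
        then show ?thesis using glo by blast
      qed (use gy in auto)
    qed
    \<comment> \<open>The image \<open>sh (z p)\<close> may be \<open>z p - 1\<close>, so the points
      of \<open>S\<close> below \<open>z p\<close>, shifted ones included, must leave room for it if
      \<open>g\<close> is to be strictly increasing.\<close>
    have lows: "x < z p - 3" if xS: "x \<in> S" and xp: "x < z p" for x
    proof -
      consider i where "i \<in> {1..k+1} - {p, p+1}" "x = z i" | "x = y b p" | "x = y (\<not> b) p"
        | q where "q < p" "x = sh (z q)"
        using xS unfolding S_def L N_def by blast
      then show ?thesis
      proof cases
        case 1
        then have "i < p" using xp zz[of p i] by (cases "i < p") auto
        then show ?thesis using 1 zz[of i p] by simp
      next
        case 4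
        then show ?thesis using zz[of q p] by (cases b) (auto simp: sh_def)
      qed (use xp yp(1)[of b] yp(1)[of "\<not> b"] in auto)
    qed
    have S1: "S \<subseteq> {..<M}"
    proof
      fix x assume "x \<in> S"
      from Scases[OF this] show "x \<in> {..<M}"
        using zM[of p] zM[of "p+1"] pk by (auto simp: y_def intro: zlt)
    qed
    have S2: "card S \<le> w"
    proof -
      have "card S \<le> card (L p) + card {y b p, y (\<not> b) p} + card ((\<lambda>q. sh (z q)) ` N)"
        unfolding S_def by (meson card_Un_le order_trans add_right_mono)
      also have "\<dots> \<le> (k - 1) + 2 + card N"
        using cardL[OF pk] finP by (intro add_mono card_image_le) (auto simp: card_insert_if N_def)
      also have "card N \<le> card {1..<k}" using P by (intro card_mono) (auto simp: N_def)
      finally show ?thesis using w by simp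
    qed
    have S3: "strict_mono_on S g"
    proof (rule strict_mono_onI)
      fix r s assume rs: "r \<in> S" "s \<in> S" "r < s"
      have shp: "z p - 3 < sh (z p)" "sh (z p) < z p + 2" using z1[OF pk(1)] by (auto simp: sh_def)
      have up: "z p + 5 \<le> z (i - 1)" if "p + 2 \<le> i" for i using zz[of p "i-1"] that by simp
      have cmp: "z (i - 1) < z (j - 1)" if "z i < z j" "p + 2 \<le> i" "p + 2 \<le> j" for i j
      proof -
        have "i < j" using that(1) by (simp add: z_def)
        then have "i - 1 < j - 1" using that(2) by simp
        from zz[OF this] show ?thesis by simp
      qed
      have big: "y c p < z i" if "p + 2 \<le> i" for c i
      proof -
        have "z (p + 2) \<le> z i" using that by (rule zle)
        then show ?thesis using yp(2)[of c] by simp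
      qed
      have ybs: "y b p < y (\<not> b) p \<Longrightarrow> z p < sh (z p)" "y (\<not> b) p < y b p \<Longrightarrow> sh (z p) < z p"
        using yp(3,4) B4 z1[OF pk(1)] by (cases b; auto simp: sh_def)+
      show "g r < g s"
        using Scases[OF rs(1)]
      proof (elim disjE conjE exE, goal_cases)
        case r: 1
        show ?case using Scases[OF rs(2)]
        proof (elim disjE conjE exE, goal_cases)
          case 1 then show ?case using r rs by simp
        next case 2 then show ?case using r rs by simp
        next case 3 then show ?case using r rs lows[OF rs(1)] shp by simp
        next case (4 i) then show ?case using r rs up[of i] by simp
        qed
      next
        case r: 2
        show ?case using Scases[OF rs(2)]
        proof (elim disjE conjE exE, goal_cases)
          case 1 then show ?case using r rs yp(1)[of b] by simp
        next case 2 then show ?case using r rs by simp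
        next case 3 then show ?case using r rs ybs by simp
        next case (4 i) then show ?case using r rs up[of i] by simp
        qed
      next
        case r: 3
        show ?case using Scases[OF rs(2)]
        proof (elim disjE conjE exE, goal_cases)
          case 1 then show ?case using r rs yp(1)[of "\<not> b"] by simp
        next case 2 then show ?case using r rs ybs by simp
        next case 3 then show ?case using r rs by simp
        next case (4 i) then show ?case using r rs up[of i] shp by simp
        qed
      next
        case r: (4 i)
        show ?case using Scases[OF rs(2)]
        proof (elim disjE conjE exE, goal_cases)
          case 1 then show ?case using r rs big[of i b] yp(1)[of b] by simp
        next case 2 then show ?case using r rs big[of i b] by simp
        next case 3 then show ?case using r rs big[of i "\<not> b"] by simp
        next case (4 j) then show ?case using r rs cmp[of i j] by simp
        qed
      qed
    qed
    have S4: "g ` S \<subseteq> {..<M}"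
    proof
      fix x assume "x \<in> g ` S"
      then obtain r where "r \<in> S" "x = g r" by blast
      with Scases[OF this(1)] show "x \<in> {..<M}"
        using zM[of p] pk by (auto simp: sh_def intro!: zlt)
    qed
    obtain e' where e': "e' \<in> E" "\<forall>Q\<subseteq>S. v e Q = v e' (g ` Q)"
      using transport[OF S1 S2 S3 S4 eE] by (elim bexE)
    have gL: "g ` L p = I - {z p}"
    proof -
      have "{1..k+1} - {p, p+1} = {1..<p} \<union> Suc ` {p+1..k}"
        using pk by (auto simp: image_iff)
      then have "g ` L p = (\<lambda>i. g (z i)) ` {1..<p} \<union> (\<lambda>i. g (z (Suc i))) ` {p+1..k}"
        unfolding L by (simp only: image_Un image_image)
      also have "\<dots> = z ` {1..<p} \<union> z ` {p+1..k}"
        using glz ghi by (intro arg_cong2[of _ _ _ _ "(\<union>)"] image_cong) auto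
      also have "\<dots> = z ` ({1..k} - {p})" unfolding image_Un[symmetric]
        using pk by (intro arg_cong[of _ _ "image z"]) auto
      also have "\<dots> = I - {z p}" unfolding I_def using injz by (auto simp: inj_def)
      finally show ?thesis .
    qed
    have zpI: "z p \<in> I" using pk by (auto simp: I_def)
    have gJ: "g ` J b p = I" using gL gy zpI by (auto simp: J_def)
    have JS: "J c p \<subseteq> S" for c by (cases c; cases b) (auto simp: J_def S_def)
    have 1: "v e' I = v e (J b p)"
      using e'(2)[rule_format, OF JS, of b] gJ by simp
    have 2: "v e' (insert (sh (z p)) (I - {z p})) = v e (J (\<not> b) p)"
      using e'(2)[rule_format, OF JS, of "\<not> b"] gL gy by (simp add: J_def)
    \<comment> \<open>\<open>g\<close> fixes \<open>z q\<close> and its shift, so the insensitivity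
      of \<open>e\<close> at \<open>J b p\<close> passes to \<open>e'\<close> at
      \<open>I\<close>.\<close>
    have 3: "v e' (insert (sh (z q)) (I - {z q})) = v e (J b p)" if q: "q \<in> P" "q < p" for q
    proof -
      have "inj_on g S" using S3 by (rule strict_mono_on_imp_inj_on)
      moreover have zq: "z q \<in> J b p" using P(1,2)[OF q(1)] q(2) by (auto simp: J_def L)
      ultimately have im: "g ` (J b p - {z q}) = I - {z q}"
        using inj_on_image_set_diff[of g S "J b p" "{z q}"] JS[of b] gJ glz[OF q(2)] by auto
      have sub: "insert (sh (z q)) (J b p - {z q}) \<subseteq> S"
        using JS[of b] q by (auto simp: S_def N_def)
      have "v e (insert (sh (z q)) (J b p - {z q})) = v e' (insert (sh (z q)) (I - {z q}))"
        using e'(2)[rule_format, OF sub] im gls[OF q(2)] by simp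
      then show ?thesis using ins[OF q(1) p q(2)] by simp
    qed
    show ?thesis using e'(1) 1 2 3 by blast
  qed
  then obtain h' where h': "\<And>p. p \<in> P \<Longrightarrow> h' p \<in> E"
    "\<And>p. p \<in> P \<Longrightarrow> v (h' p) I = v e (J b p)"
    "\<And>p. p \<in> P \<Longrightarrow> v (h' p) (insert (sh (z p)) (I - {z p})) = v e (J (\<not> b) p)"
    "\<And>p q. p \<in> P \<Longrightarrow> q \<in> P \<Longrightarrow> q < p \<Longrightarrow> v (h' p) (insert (sh (z q)) (I - {z q})) = v e (J b p)"
    by metis
  \<comment> \<open>For \<open>q < p\<close>, shifting \<open>z q\<close> changes the value at
    coordinate \<open>h' q\<close> but not at \<open>h' p\<close>.\<close>
  have "inj_on h' P"
  proof (rule linorder_inj_onI')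
    fix q p assume qp: "q \<in> P" "p \<in> P" "q < p"
    show "h' q \<noteq> h' p"
      using h'(2)[OF qp(1)] h'(3)[OF qp(1)] h'(2)[OF qp(2)] h'(4)[OF qp(2,1,3)] P(3)[OF qp(1)]
      by (cases b) auto
  qed
  moreover have "h' ` P \<subseteq> {e \<in> E. v e I \<noteq> 0}" using h'(1,2) P(4) by auto
  ultimately have "card P \<le> card {e \<in> E. v e I \<noteq> 0}"
    using fin by (intro card_inj_on_le[of h']) auto
  also have "\<dots> \<le> K"
  proof (rule sparse)
    show "I \<subseteq> {..<M}" by (auto simp: I_def intro: zlt)
    show "card I = k" unfolding I_def using injz by (subst card_image) (auto simp: inj_on_def)
  qed
  finally show False using cardP by simp
qed

end

section \<open>Ramsey's theorem for order types of finite sets\<close>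

lemma sorted_list_of_set_image_strict_mono:
  fixes f :: "'a::linorder \<Rightarrow> 'b::linorder"
  assumes "finite S" "strict_mono_on S f"
  shows "sorted_list_of_set (f ` S) = map f (sorted_list_of_set S)"
proof -
  have "sorted_wrt (\<lambda>x y. f x < f y) (sorted_list_of_set S)"
    by (rule sorted_wrt_mono_rel[OF _ strict_sorted_list_of_set])
      (use assms in \<open>auto simp: strict_mono_on_def\<close>)
  moreover have "card (f ` S) = card S"
    using assms by (intro card_image strict_mono_on_imp_inj_on)
  ultimately show ?thesis
    using assms(1) by (subst sorted_list_of_set_unique[symmetric]) (auto simp: sorted_wrt_map)
qed

text \<open>Each \<open>w\<close>-set is coloured by the set of patterns that the coordinates show
  on its subsets; in sets of the same colour every coordinate finds a partner. A colour ignores how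
  many coordinates share a pattern, so one \<open>N\<close> works for index sets \<open>E\<close> of
  every size.\<close>

lemma ramsey_order_types:
  fixes V :: "'v set" and M w :: nat
  assumes "finite V"
  shows "\<exists>N. \<forall>(E :: 'e set) (\<phi> :: 'e \<Rightarrow> nat set \<Rightarrow> 'v). (\<forall>e\<in>E. \<forall>P. \<phi> e P \<in> V) \<longrightarrow>
    (\<exists>h. strict_mono_on {..<M} h \<and> h ` {..<M} \<subseteq> {..<N} \<and>
      (\<forall>S g. S \<subseteq> {..<M} \<and> card S = w \<and> strict_mono_on S g \<and> g ` S \<subseteq> {..<M} \<longrightarrow>
        (\<forall>e\<in>E. \<exists>e'\<in>E. \<forall>P\<subseteq>S. \<phi> e (h ` P) = \<phi> e' (h ` g ` P))))"
proof -
  define C where "C = Pow (Pow {..<w} \<rightarrow>\<^sub>E V)"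
  have "finite C" using assms by (simp add: C_def finite_PiE)
  \<comment> \<open>\<open>partn_lst\<close> takes its colours from an initial segment of the
    naturals, hence the numbering \<open>\<iota>\<close>.\<close>
  then obtain \<iota> :: "(nat set \<Rightarrow> 'v) set \<Rightarrow> nat" and c where \<iota>: "\<iota> ` C = {i. i < c}" "inj_on \<iota> C"
    using finite_imp_inj_to_nat_seg by metis
  obtain N :: nat where N: "partn_lst {..<N} (replicate c M) w" using ramsey_full by blast
  show ?thesis
  proof (rule exI[of _ N], intro allI impI)
    fix E :: "'e set" and \<phi> :: "'e \<Rightarrow> nat set \<Rightarrow> 'v"
    assume \<phi>: "\<forall>e\<in>E. \<forall>P. \<phi> e P \<in> V"
    \<comment> \<open>Subsets of \<open>W\<close> are addressed by positions in its increasing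
      enumeration, which makes patterns on different sets comparable.\<close>
    define pat where "pat W e = restrict (\<lambda>P. \<phi> e ((!) (sorted_list_of_set W) ` P)) (Pow {..<w})" for W e
    have pat: "pat W ` E \<in> C" for W
      using \<phi> unfolding C_def pat_def Pow_iff image_subset_iff restrict_PiE_iff by blast
    then have "(\<lambda>W. \<iota> (pat W ` E)) \<in> nsets {..<N} w \<rightarrow> {..<length (replicate c M)}"
      using \<iota>(1) by (auto simp: image_iff set_eq_iff)
    from N[unfolded partn_lst_def, rule_format, OF this]
    obtain i H where i: "i < c" and H: "H \<in> nsets {..<N} M"
      and mono: "\<And>W. W \<in> nsets H w \<Longrightarrow> \<iota> (pat W ` E) = i"
      by (auto simp: monochromatic_def image_subset_iff)
    define h where "h = (!) (sorted_list_of_set H)"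
    have H': "H \<subseteq> {..<N}" "finite H" "card H = M" using H by (auto simp: nsets_def)
    have hm: "strict_mono_on {..<M} h"
      using H' sorted_wrt_nth_less[OF strict_sorted_list_of_set[of H]]
      by (auto simp: strict_mono_on_def h_def)
    have hH: "h ` {..<M} \<subseteq> H"
      using H' nth_mem[of _ "sorted_list_of_set H"] by (auto simp: h_def)
    have main: "\<exists>e'\<in>E. \<forall>P\<subseteq>S. \<phi> e (h ` P) = \<phi> e' (h ` g ` P)"
      if S: "S \<subseteq> {..<M}" "card S = w" "strict_mono_on S g" "g ` S \<subseteq> {..<M}" and e: "e \<in> E" for S g e
    proof -
      have finS: "finite S" using S(1) finite_subset by blast
      let ?s = "sorted_list_of_set S"
      have m1: "strict_mono_on S h" using hm S(1) by (auto simp: strict_mono_on_def)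
      have m2: "strict_mono_on S (h \<circ> g)"
        using hm S by (auto simp: strict_mono_on_def image_subset_iff)
      have e1: "sorted_list_of_set (h ` S) ! i = h (?s ! i)"
        and e2: "sorted_list_of_set ((h \<circ> g) ` S) ! i = h (g (?s ! i))" if "i < w" for i
        using that S(2) sorted_list_of_set_image_strict_mono[OF finS m1]
          sorted_list_of_set_image_strict_mono[OF finS m2] by simp_all
      have "h ` S \<in> nsets H w" "(h \<circ> g) ` S \<in> nsets H w"
        using S finS hH card_image[OF strict_mono_on_imp_inj_on[OF m1]]
          card_image[OF strict_mono_on_imp_inj_on[OF m2]]
        by (auto simp: nsets_def image_subset_iff subset_iff)
      then have "\<iota> (pat (h ` S) ` E) = \<iota> (pat ((h \<circ> g) ` S) ` E)"
        using mono by simp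
      then have "pat (h ` S) ` E = pat ((h \<circ> g) ` S) ` E" using \<iota>(2) pat by (meson inj_onD)
      then obtain e' where e': "e' \<in> E" "pat (h ` S) e = pat ((h \<circ> g) ` S) e'" using e by blast
      have "\<phi> e (h ` P) = \<phi> e' (h ` g ` P)" if "P \<subseteq> S" for P
      proof -
        \<comment> \<open>The positions of \<open>P\<close> in \<open>S\<close>; strictly increasing
          maps preserve them.\<close>
        define Q where "Q = {i. i < w \<and> ?s ! i \<in> P}"
        have Q: "(!) ?s ` Q = P"
        proof -
          have "\<exists>i<w. ?s ! i = x" if "x \<in> P" for x
            using that \<open>P \<subseteq> S\<close> finS S(2) in_set_conv_nth[of x ?s] by auto
          then show ?thesis by (force simp: Q_def image_iff)
        qed
        have Qw: "Q \<subseteq> {..<w}" by (auto simp: Q_def)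
        have "\<phi> e ((!) (sorted_list_of_set (h ` S)) ` Q) = \<phi> e' ((!) (sorted_list_of_set ((h \<circ> g) ` S)) ` Q)"
          using fun_cong[OF e'(2), of Q] Qw by (simp add: pat_def)
        moreover have "(!) (sorted_list_of_set (h ` S)) ` Q = h ` (!) ?s ` Q"
          unfolding image_image using Qw by (intro image_cong) (auto simp: e1)
        moreover have "(!) (sorted_list_of_set ((h \<circ> g) ` S)) ` Q = h ` g ` (!) ?s ` Q"
          unfolding image_image[of _ "(!) ?s"] image_image[of h]
          by (intro image_cong refl) (metis Qw e2 lessThan_iff subsetD)
        ultimately show ?thesis using Q by simp
      qed
      then show ?thesis using e'(1) by blast
    qed
    show "\<exists>h. strict_mono_on {..<M} h \<and> h ` {..<M} \<subseteq> {..<N} \<and>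
      (\<forall>S g. S \<subseteq> {..<M} \<and> card S = w \<and> strict_mono_on S g \<and> g ` S \<subseteq> {..<M} \<longrightarrow>
        (\<forall>e\<in>E. \<exists>e'\<in>E. \<forall>P\<subseteq>S. \<phi> e (h ` P) = \<phi> e' (h ` g ` P)))"
      using hm hH H'(1) main by (intro exI[of _ h]) blast
  qed
qed

text \<open>Reduces to sets of exactly \<open>w\<close> elements in \<open>{..<M + w}\<close>, where
  the points from \<open>M\<close> on serve as padding.\<close>

lemma ramsey_order_types_le:
  fixes V :: "'v set" and M w :: nat
  assumes "finite V"
  shows "\<exists>N. \<forall>(E :: 'e set) (\<phi> :: 'e \<Rightarrow> nat set \<Rightarrow> 'v). (\<forall>e\<in>E. \<forall>P. \<phi> e P \<in> V) \<longrightarrow>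
    (\<exists>h. inj_on h {..<M} \<and> h ` {..<M} \<subseteq> {..<N} \<and>
      (\<forall>S g. S \<subseteq> {..<M} \<and> card S \<le> w \<and> strict_mono_on S g \<and> g ` S \<subseteq> {..<M} \<longrightarrow>
        (\<forall>e\<in>E. \<exists>e'\<in>E. \<forall>P\<subseteq>S. \<phi> e (h ` P) = \<phi> e' (h ` g ` P))))"
proof -
  obtain N where N: "\<And>(E :: 'e set) (\<phi> :: 'e \<Rightarrow> nat set \<Rightarrow> 'v). (\<forall>e\<in>E. \<forall>P. \<phi> e P \<in> V) \<Longrightarrow>
    \<exists>h. strict_mono_on {..<M + w} h \<and> h ` {..<M + w} \<subseteq> {..<N} \<and>
      (\<forall>S g. S \<subseteq> {..<M + w} \<and> card S = w \<and> strict_mono_on S g \<and> g ` S \<subseteq> {..<M + w} \<longrightarrow>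
        (\<forall>e\<in>E. \<exists>e'\<in>E. \<forall>P\<subseteq>S. \<phi> e (h ` P) = \<phi> e' (h ` g ` P)))"
    using ramsey_order_types[OF assms, of "M + w" w, where 'e = 'e] by metis
  show ?thesis
  proof (rule exI[of _ N], intro allI impI)
    fix E :: "'e set" and \<phi> :: "'e \<Rightarrow> nat set \<Rightarrow> 'v"
    assume "\<forall>e\<in>E. \<forall>P. \<phi> e P \<in> V"
    from N[OF this] obtain h where h: "strict_mono_on {..<M + w} h" "h ` {..<M + w} \<subseteq> {..<N}"
      and tr: "\<And>S g e. \<lbrakk>S \<subseteq> {..<M + w}; card S = w; strict_mono_on S g; g ` S \<subseteq> {..<M + w}; e \<in> E\<rbrakk>
        \<Longrightarrow> \<exists>e'\<in>E. \<forall>P\<subseteq>S. \<phi> e (h ` P) = \<phi> e' (h ` g ` P)"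
      by metis
    have main: "\<exists>e'\<in>E. \<forall>P\<subseteq>S. \<phi> e (h ` P) = \<phi> e' (h ` g ` P)"
      if S: "S \<subseteq> {..<M}" "card S \<le> w" "strict_mono_on S g" "g ` S \<subseteq> {..<M}" and e: "e \<in> E" for S g e
    proof -
      have finS: "finite S" using S(1) finite_subset by blast
      \<comment> \<open>Padding at the top makes every \<open>S\<close> have exactly \<open>w\<close> elements.\<close>
      define S' where "S' = S \<union> {M..<M + (w - card S)}"
      define g' where "g' x = (if x < M then g x else x)" for x
      have a1: "S' \<subseteq> {..<M + w}" using S(1) by (auto simp: S'_def)
      have "S \<inter> {M..<M + (w - card S)} = {}" using S(1) by auto
      then have a2: "card S' = w" using S(2) finS by (simp add: S'_def card_Un_disjoint)
      have gM: "g x < M" if "x \<in> S" for x using S(4) that by auto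
      have a3: "strict_mono_on S' g'"
      proof (rule strict_mono_onI)
        fix r s assume rs: "r \<in> S'" "s \<in> S'" "r < s"
        show "g' r < g' s"
        proof (cases "s < M")
          case True
          then have "r \<in> S" "s \<in> S" using rs by (auto simp: S'_def)
          then show ?thesis using True rs S(3) by (simp add: g'_def strict_mono_on_def)
        next
          case False
          then show ?thesis using rs gM[of r] by (auto simp: g'_def S'_def)
        qed
      qed
      have a4: "g' ` S' \<subseteq> {..<M + w}"
      proof (rule image_subsetI)
        fix x assume "x \<in> S'"
        then show "g' x \<in> {..<M + w}"
          using gM[of x] a1 by (auto simp: g'_def S'_def)
      qed
      obtain e' where e': "e' \<in> E" "\<forall>P\<subseteq>S'. \<phi> e (h ` P) = \<phi> e' (h ` g' ` P)"
        using tr[OF a1 a2 a3 a4 e] by (elim bexE)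
      have "g' ` P = g ` P" if "P \<subseteq> S" for P
        using that S(1) by (intro image_cong) (auto simp: g'_def)
      then show ?thesis using e' by (intro bexI[of _ e']) (auto simp: S'_def)
    qed
    have "inj_on h {..<M}"
      using strict_mono_on_imp_inj_on[OF h(1)] by (rule inj_on_subset) auto
    moreover have "h ` {..<M} \<subseteq> {..<N}" using h(2) by (auto simp: image_subset_iff)
    ultimately show "\<exists>h. inj_on h {..<M} \<and> h ` {..<M} \<subseteq> {..<N} \<and>
      (\<forall>S g. S \<subseteq> {..<M} \<and> card S \<le> w \<and> strict_mono_on S g \<and> g ` S \<subseteq> {..<M} \<longrightarrow>
        (\<forall>e\<in>E. \<exists>e'\<in>E. \<forall>P\<subseteq>S. \<phi> e (h ` P) = \<phi> e' (h ` g ` P)))"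
      using main by (intro exI[of _ h] conjI allI impI ballI) auto
  qed
qed

section \<open>Slice strings as sets, and Hamming distances\<close>

definition indicator_string :: "nat \<Rightarrow> nat set \<Rightarrow> bool list" where
  "indicator_string n X = map (\<lambda>i. i \<in> X) [0..<n]"

lemma indicator_string_middle_slice:
  assumes "X \<subseteq> {..<2 * n}" "card X = n"
  shows "indicator_string (2 * n) X \<in> middle_slice n"
proof -
  have "{i. i < 2 * n \<and> map (\<lambda>i. i \<in> X) [0..<2 * n] ! i} = X" using assms(1) by auto
  then show ?thesis using assms(2)
    by (simp add: indicator_string_def middle_slice_def bitstrings_def hamming_weight_def)
qed

text \<open>Equal cardinality makes the two halves of the symmetric difference equally
  large.\<close>

lemma hamming_dist_indicator_string:
  assumes "X \<subseteq> {..<n}" "Y \<subseteq> {..<n}" "card X = card Y"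
  shows "hamming_dist (indicator_string n X) (indicator_string n Y) = 2 * card (X - Y)"
proof -
  have fin: "finite X" "finite Y" using assms finite_subset by blast+
  have "{i. i < n \<and> map (\<lambda>i. i \<in> X) [0..<n] ! i \<noteq> map (\<lambda>i. i \<in> Y) [0..<n] ! i} = (X - Y) \<union> (Y - X)"
    using assms by auto
  moreover have "card ((X - Y) \<union> (Y - X)) = card (X - Y) + card (Y - X)"
    using fin by (intro card_Un_disjoint) auto
  moreover have "card (X - Y) = card (Y - X)"
    using fin assms(3) card_le_sym_Diff[of X Y] card_le_sym_Diff[of Y X] by simp
  ultimately show ?thesis by (simp add: indicator_string_def hamming_dist_def)
qed

text \<open>Exclusive or of bits is \<open>x + y - 2 * x * y\<close>. The product is the only term
  that survives an alternating sum over two choices of \<open>x\<close> and two of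
  \<open>y\<close>.\<close>

lemma hamming_dist_eq_sum:
  assumes "length x = m"
  shows "int (hamming_dist x y) = (\<Sum>e<m. of_bool (x ! e) + of_bool (y ! e) - 2 * of_bool (x ! e) * of_bool (y ! e))"
proof -
  have "int (hamming_dist x y) = (\<Sum>e<m. of_bool (x ! e \<noteq> y ! e))"
    using assms by (simp add: hamming_dist_def sum.If_cases of_bool_def Int_def conj_commute)
  also have "\<dots> = (\<Sum>e<m. of_bool (x ! e) + of_bool (y ! e) - 2 * of_bool (x ! e) * of_bool (y ! e))"
    by (intro sum.cong) auto
  finally show ?thesis .
qed

text \<open>The triangle inequality through \<open>x\<close>. A code controls only distances between
  the two players, so two values of one player are compared through a value of the other.\<close>

lemma card_differ_le:
  assumes "length y = m" "length z = m"
  shows "card {e \<in> {..<m}. y ! e \<noteq> z ! e} \<le> hamming_dist y x + hamming_dist z x"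
proof -
  have "{e \<in> {..<m}. y ! e \<noteq> z ! e} \<subseteq> {i. i < m \<and> y ! i \<noteq> x ! i} \<union> {i. i < m \<and> z ! i \<noteq> x ! i}"
    by auto
  then have "card {e \<in> {..<m}. y ! e \<noteq> z ! e} \<le> card ({i. i < m \<and> y ! i \<noteq> x ! i} \<union> {i. i < m \<and> z ! i \<noteq> x ! i})"
    by (intro card_mono) auto
  also have "\<dots> \<le> card {i. i < m \<and> y ! i \<noteq> x ! i} + card {i. i < m \<and> z ! i \<noteq> x ! i}"
    by (rule card_Un_le)
  finally show ?thesis using assms by (simp add: hamming_dist_def)
qed

lemma hamming_dist_commute: "length x = length y \<Longrightarrow> hamming_dist x y = hamming_dist y x"
  unfolding hamming_dist_def by (intro arg_cong[of _ _ card]) auto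

section \<open>From a two-player code to a sensitive chain\<close>

theorem theorem4p1:
  fixes f :: "nat \<Rightarrow> nat" and m :: "nat \<Rightarrow> nat"
  assumes "infinite {n. \<exists>E1 E2. two_player_code {0, 2, 4, 6} f (middle_slice n) (m n) E1 E2}"
  shows "real (f 4) = 1 / 2 * (real (f 2) + real (f 6))"
proof (rule ccontr)
  assume "real (f 4) \<noteq> 1 / 2 * (real (f 2) + real (f 6))"
  then have ne: "int (f 4) - int (f 2) \<noteq> int (f 6) - int (f 4)" by auto
  define K where "K = f 0 + f 2"
  define k where "k = 2 * K * K + 2"
  define B :: nat where "B = 9 ^ K + 4"
  define w where "w = 2 * k + 4"
  define M where "M = B * (k + 2)"
  \<comment> \<open>\<open>N\<close> is fixed before \<open>n\<close>, hence before the code and its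
    length \<open>m n\<close>; the Ramsey bound is uniform in the index set.\<close>
  obtain N where N: "\<And>(E :: nat set) (\<phi> :: nat \<Rightarrow> nat set \<Rightarrow> int). (\<forall>e\<in>E. \<forall>P. \<phi> e P \<in> {-1, 0, 1}) \<Longrightarrow>
    \<exists>h. inj_on h {..<M} \<and> h ` {..<M} \<subseteq> {..<N} \<and>
      (\<forall>S g. S \<subseteq> {..<M} \<and> card S \<le> w \<and> strict_mono_on S g \<and> g ` S \<subseteq> {..<M} \<longrightarrow>
        (\<forall>e\<in>E. \<exists>e'\<in>E. \<forall>P\<subseteq>S. \<phi> e (h ` P) = \<phi> e' (h ` g ` P)))"
    using ramsey_order_types_le[of "{-1, 0, 1 :: int}" M w, where 'e = nat] by (metis finite.emptyI finite_insert)
  obtain n where n: "N + k + 2 \<le> n"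
    and "\<exists>E1 E2. two_player_code {0, 2, 4, 6} f (middle_slice n) (m n) E1 E2"
    using assms unfolding infinite_nat_iff_unbounded_le by blast
  then obtain E1 E2 where code: "two_player_code {0, 2, 4, 6} f (middle_slice n) (m n) E1 E2" by blast
  \<comment> \<open>\<open>I\<close> lives below \<open>N\<close>, the switch \<open>c\<close> is
    \<open>N\<close> or \<open>N+1\<close>, and a common block of \<open>n - k - 1\<close> points
    raises the weight to \<open>n\<close>.\<close>
  define X where "X c I = insert c I \<union> {N+2..<N+2+(n-k-1)}" for c I
  define s where "s c I = indicator_string (2 * n) (X c I)" for c I
  have X: "X c I \<subseteq> {..<2 * n}" "card (X c I) = n"
    if "I \<subseteq> {..<N}" "card I = k" "c \<in> {N, N+1}" for c I
  proof -
    show "X c I \<subseteq> {..<2 * n}" using that n by (auto simp: X_def)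
    have "finite I" using that finite_subset by blast
    moreover have "insert c I \<inter> {N+2..<N+2+(n-k-1)} = {}" "c \<notin> I" using that by auto
    ultimately have "card (X c I) = Suc (card I) + (n - k - 1)"
      by (simp add: X_def card_Un_disjoint)
    then show "card (X c I) = n" using that n by simp
  qed
  have slice: "s c I \<in> middle_slice n" if "I \<subseteq> {..<N}" "card I = k" "c \<in> {N, N+1}" for c I
    using X[OF that] by (simp add: s_def indicator_string_middle_slice)
  have dist: "hamming_dist (s c I) (s c' I') = 2 * (card (I - I') + of_bool (c \<noteq> c'))"
    if "I \<subseteq> {..<N}" "card I = k" "c \<in> {N, N+1}" "I' \<subseteq> {..<N}" "card I' = k" "c' \<in> {N, N+1}" for c I c' I'
  proof -
    have "finite (I - I')" using that finite_subset by blast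
    moreover have "c \<notin> I - I'" using that by auto
    moreover have "X c I - X c' I' = (if c = c' then I - I' else insert c (I - I'))"
      using that by (auto simp: X_def)
    ultimately show ?thesis using X[OF that(1-3)] X[OF that(4-6)]
      by (simp add: s_def hamming_dist_indicator_string)
  qed
  have E: "length (E1 x) = m n" "length (E2 x) = m n" if "x \<in> middle_slice n" for x
    using code that by (auto simp: two_player_code_def bitstrings_def)
  have codeD: "hamming_dist (E1 (s c I)) (E2 (s c' I')) = f (2 * (card (I - I') + of_bool (c \<noteq> c')))"
    if "I \<subseteq> {..<N}" "card I = k" "c \<in> {N, N+1}" "I' \<subseteq> {..<N}" "card I' = k" "c' \<in> {N, N+1}"
      "card (I - I') \<le> 2" for c I c' I'
  proof -
    \<comment> \<open>The sets contribute at most 4 to the distance and the switch at most 2, which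
      stays within the domain of \<open>f\<close>.\<close>
    have "2 * (card (I - I') + of_bool (c \<noteq> c')) \<in> {0, 2, 4, 6}"
      using that(7) by (cases "c = c'") (auto simp: le_Suc_eq numeral_2_eq_2)
    then show ?thesis using code slice that(1-6) dist[OF that(1-6)]
      unfolding two_player_code_def by metis
  qed
  define u where "u e I = (of_bool (E1 (s N I) ! e) - of_bool (E1 (s (N+1) I) ! e) :: int)" for e I
  define v where "v e I = (of_bool (E2 (s N I) ! e) - of_bool (E2 (s (N+1) I) ! e) :: int)" for e I
  \<comment> \<open>In the mixed second difference over \<open>c\<close> and \<open>c'\<close> the
    linear terms cancel and \<open>-2\<close> times the inner product remains. Equal switches give
    distance \<open>2 * d\<close>, different ones \<open>2 * d + 2\<close>.\<close>
  have inner: "(\<Sum>e<m n. u e I * v e I') = int (f (2 * d + 2)) - int (f (2 * d))"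
    if I: "I \<subseteq> {..<N}" "card I = k" "I' \<subseteq> {..<N}" "card I' = k" and d: "card (I - I') = d" "d \<le> 2" for I I' d
  proof -
    define t :: "nat \<Rightarrow> nat \<Rightarrow> nat \<Rightarrow> int" where "t c c' e = of_bool (E1 (s c I) ! e) + of_bool (E2 (s c' I') ! e)
        - 2 * of_bool (E1 (s c I) ! e) * of_bool (E2 (s c' I') ! e)" for c c' e
    have D: "int (f (2 * (d + of_bool (c \<noteq> c')))) = (\<Sum>e<m n. t c c' e)"
      if "c \<in> {N, N+1}" "c' \<in> {N, N+1}" for c c'
      using codeD[OF I(1,2) that(1) I(3,4) that(2)] d
        hamming_dist_eq_sum[OF E(1)[OF slice[OF I(1,2) that(1)]], of "E2 (s c' I')"] by (simp add: t_def)
    have "- 2 * (\<Sum>e<m n. u e I * v e I') = (\<Sum>e<m n. t N N e - t N (N+1) e - t (N+1) N e + t (N+1) (N+1) e)"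
      unfolding sum_distrib_left by (intro sum.cong) (auto simp: t_def u_def v_def of_bool_def)
    also have "\<dots> = (\<Sum>e<m n. t N N e) - (\<Sum>e<m n. t N (N+1) e) - (\<Sum>e<m n. t (N+1) N e) + (\<Sum>e<m n. t (N+1) (N+1) e)"
      by (simp only: sum.distrib sum_subtractf)
    also have "\<dots> = int (f (2 * d)) - int (f (2 * d + 2)) - int (f (2 * d + 2)) + int (f (2 * d))"
      using D[of N N] D[of N "N+1"] D[of "N+1" N] D[of "N+1" "N+1"] by simp
    finally have "- 2 * (\<Sum>e<m n. u e I * v e I') = int (f (2 * d)) - int (f (2 * d + 2)) - int (f (2 * d + 2)) + int (f (2 * d))" .
    then show ?thesis by simp
  qed
  \<comment> \<open>Both values of \<open>E1\<close> lie at distances \<open>f 0\<close> and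
    \<open>f 2\<close> from \<open>E2 (s N I)\<close>; with the players exchanged,
    \<open>E1 (s N I)\<close> serves for \<open>E2\<close>.\<close>
  have su: "card {e \<in> {..<m n}. u e I \<noteq> 0} \<le> K" and sv: "card {e \<in> {..<m n}. v e I \<noteq> 0} \<le> K"
    if I: "I \<subseteq> {..<N}" "card I = k" for I
  proof -
    have "s N I \<in> middle_slice n" "s (N+1) I \<in> middle_slice n" using slice I by auto
    note l = E[OF this(1)] E[OF this(2)]
    have "{e \<in> {..<m n}. u e I \<noteq> 0} = {e \<in> {..<m n}. E1 (s N I) ! e \<noteq> E1 (s (N+1) I) ! e}"
      "{e \<in> {..<m n}. v e I \<noteq> 0} = {e \<in> {..<m n}. E2 (s N I) ! e \<noteq> E2 (s (N+1) I) ! e}"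
      by (auto simp: u_def v_def)
    moreover have "hamming_dist (E1 (s N I)) (E2 (s N I)) = f 0"
      "hamming_dist (E1 (s (N+1) I)) (E2 (s N I)) = f 2"
      "hamming_dist (E1 (s N I)) (E2 (s (N+1) I)) = f 2"
      using codeD[OF I _ I, of N N] codeD[OF I _ I, of "N+1" N] codeD[OF I _ I, of N "N+1"] by simp_all
    ultimately show "card {e \<in> {..<m n}. u e I \<noteq> 0} \<le> K" "card {e \<in> {..<m n}. v e I \<noteq> 0} \<le> K"
      using card_differ_le[OF l(1,3), of "E2 (s N I)"] card_differ_le[OF l(2,4), of "E1 (s N I)"]
        hamming_dist_commute l by (simp_all add: K_def)
  qed
  have vr: "v e I \<in> {-1, 0, 1}" for e I by (auto simp: v_def)
  from N[of "{..<m n}" v] vr obtain h where h: "inj_on h {..<M}" "h ` {..<M} \<subseteq> {..<N}"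
    and tr: "\<And>S g e. \<lbrakk>S \<subseteq> {..<M}; card S \<le> w; strict_mono_on S g; g ` S \<subseteq> {..<M}; e \<in> {..<m n}\<rbrakk>
      \<Longrightarrow> \<exists>e'\<in>{..<m n}. \<forall>P\<subseteq>S. v e (h ` P) = v e' (h ` g ` P)"
    by metis
  have hP: "h ` P \<subseteq> {..<N}" "card (h ` P) = card P" if "P \<subseteq> {..<M}" for P
    using h that card_image[OF inj_on_subset[OF h(1) that]] by auto
  interpret sparse_homogeneous "\<lambda>e P. v e (h ` P)" "{..<m n}" k K M w
    by unfold_locales (use vr sv hP tr in auto)
  define I where "I = (\<lambda>i. B * i) ` {1..k}"
  define L where "L p = (\<lambda>i. B * i) ` ({1..k+1} - {p, p+1})" for p
  define F where "F = {e \<in> {..<m n}. u e (h ` I) \<noteq> 0}"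
  have B5: "5 \<le> B" by (simp add: B_def)
  have Bi: "B * i = B * j \<longleftrightarrow> i = j" for i j using B5 by simp
  have B2: "B * i \<noteq> B * p + 2" for i p
  proof (cases "i \<le> p")
    case True
    then have "B * i \<le> B * p" by (rule mult_le_mono2)
    then show ?thesis by linarith
  next
    case False
    then have "B * (p + 1) \<le> B * i" by (intro mult_le_mono2) auto
    then show ?thesis using B5 by simp
  qed
  have BM: "B * i + 4 < M" if "i \<le> k + 1" for i
  proof -
    have "B * (i + 1) \<le> M" unfolding M_def using that by (intro mult_le_mono) auto
    then show ?thesis using B5 by simp
  qed
  have BM0: "B * i < M" if "i \<le> k + 1" for i using BM[OF that] by simp
  have IM: "I \<subseteq> {..<M}" and LM: "L p \<subseteq> {..<M}" for p using BM0 by (auto simp: I_def L_def)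
  have cI: "card I = k" unfolding I_def using Bi by (subst card_image) (auto simp: inj_on_def)
  have hdiff: "card (h ` P - h ` Q) = card (P - Q)" if "P \<subseteq> {..<M}" "Q \<subseteq> {..<M}" for P Q
  proof -
    have "h ` P - h ` Q = h ` (P - Q)"
      using inj_on_image_set_diff[OF h(1), of P Q] that by auto
    then show ?thesis using hP(2)[of "P - Q"] that by auto
  qed
  show False
  proof (rule no_sensitive_chain[of B F])
    show "F \<subseteq> {..<m n}" by (auto simp: F_def)
    show "card F \<le> K" unfolding F_def using su hP IM cI by simp
    fix p :: nat assume p: "1 \<le> p" "p < k"
    let ?J1 = "insert (B * (p + 1)) (L p)" and ?J2 = "insert (B * p + 2) (L p)"
    have cL: "card (L p) = k - 1"
    proof -
      have "card (L p) = card ({1..k+1} - {p, p+1})"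
        unfolding L_def using Bi by (intro card_image) (auto simp: inj_on_def)
      also have "\<dots> = card {1..k+1} - card {p, p+1}" using p by (intro card_Diff_subset) auto
      finally show ?thesis by simp
    qed
    have finL: "finite (L p)" by (simp add: L_def)
    have nin1: "B * (p + 1) \<notin> L p" using Bi[of "p + 1"] unfolding L_def image_iff by (metis DiffD2 insertCI)
    have nin2: "B * p + 2 \<notin> L p" using B2 unfolding L_def image_iff by metis
    have c1: "card ?J1 = k" "card ?J2 = k" using cL nin1 nin2 finL p by simp_all
    have JM: "?J1 \<subseteq> {..<M}" "?J2 \<subseteq> {..<M}" using LM BM[of p] BM0[of "p+1"] p by auto
    have injB: "inj ((*) B)" using Bi by (intro injI) blast
    \<comment> \<open>Among the indices of \<open>I\<close>, only \<open>p\<close> is missing from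
      \<open>?J1\<close>, while \<open>p\<close> and \<open>p + 1\<close> are missing from
      \<open>?J2\<close>, whose extra point \<open>B * p + 2\<close> is no multiple of
      \<open>B\<close>. This gives distances 1 and 2.\<close>
    have "?J1 = (\<lambda>i. B * i) ` insert (p + 1) ({1..k+1} - {p, p+1})" unfolding L_def by (rule image_insert[symmetric])
    then have "I - ?J1 = (\<lambda>i. B * i) ` ({1..k} - insert (p + 1) ({1..k+1} - {p, p+1}))"
      unfolding I_def by (simp only: image_set_diff[OF injB])
    also have "{1..k} - insert (p + 1) ({1..k+1} - {p, p+1}) = {p}" using p by auto
    finally have "I - ?J1 = {B * p}" by simp
    moreover have "I - ?J2 = {B * p, B * (p + 1)}"
    proof -
      have "B * p + 2 \<notin> I" unfolding I_def image_iff using B2 by metis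
      then have "I - ?J2 = I - L p" by blast
      also have "\<dots> = (\<lambda>i. B * i) ` ({1..k} - ({1..k+1} - {p, p+1}))"
        unfolding I_def L_def by (simp only: image_set_diff[OF injB])
      also have "{1..k} - ({1..k+1} - {p, p+1}) = {p, p + 1}" using p by auto
      finally show ?thesis by simp
    qed
    ultimately have "card (I - ?J1) = 1" "card (I - ?J2) = 2" using Bi[of p "p+1"] by simp_all
    then have "(\<Sum>e<m n. u e (h ` I) * v e (h ` ?J1)) = int (f 4) - int (f 2)"
      "(\<Sum>e<m n. u e (h ` I) * v e (h ` ?J2)) = int (f 6) - int (f 4)"
      using inner[of "h ` I" "h ` ?J1" 1] inner[of "h ` I" "h ` ?J2" 2]
        hP[OF IM] hP[OF JM(1)] hP[OF JM(2)] hdiff[OF IM JM(1)] hdiff[OF IM JM(2)] c1 cI by simp_all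
    with ne have "(\<Sum>e<m n. u e (h ` I) * v e (h ` ?J1)) \<noteq> (\<Sum>e<m n. u e (h ` I) * v e (h ` ?J2))"
      by simp
    \<comment> \<open>Different sums have a different summand, and there the factor from
      \<open>u\<close> is nonzero.\<close>
    then obtain e where "e < m n" "u e (h ` I) * v e (h ` ?J1) \<noteq> u e (h ` I) * v e (h ` ?J2)"
      by (meson lessThan_iff sum.cong)
    then have "e \<in> F" "v e (h ` ?J1) \<noteq> v e (h ` ?J2)" by (auto simp: F_def)
    then show "\<exists>e\<in>F. v e (h ` insert (B * (p + 1)) ((\<lambda>i. B * i) ` ({1..k+1} - {p, p+1})))
        \<noteq> v e (h ` insert (B * p + 2) ((\<lambda>i. B * i) ` ({1..k+1} - {p, p+1})))"
      unfolding L_def by blast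
  qed (simp_all add: k_def B_def w_def M_def)
qed

end
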